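(* Let $\Delta$ and $\Delta'$ be two triangles which are both isosceles, or both right, or both SAP triangles, and suppose that all the side lengths of $\Delta$ and $\Delta'$ are rational numbers. (i) If $\Delta,\Delta'$ are not regular and $[T_q(\Delta)]=[\Delta']$ for a real number $q$, then $q$ is rational. (ii) $\Delta\sim\Delta'$ if and only if $\Delta\sim_{\mathbb{Q}}\Delta'$.
   Context: Triangles are nondegenerate triangles in the Euclidean plane $\cong\mathbb{C}$. An SAP triangle is a triangle whose side lengths, in some order, are in arithmetic progression. Two triangles are called similar if some orientation-preserving similarity of the plane carries one onto the other (labels of vertices need not be matched); $[\Delta]$ denotes the similarity class of $\Delta$. Equisection operators: for $q\in\mathbb{R}$ and a triangle $\triangle ABC$ with vertices listed anticlockwise, $T_q(\triangle ABC)=\triangle A'B'C'$ where $A'=qB+(1-q)C$, $B'=qC+(1-q)A$, $C'=qA+(1-q)B$. Equisectional equivalence $\sim$ is the equivalence relation on the set of triangles generated by similarity and $\{T_q\}_{q\in\mathbb{R}}$. Rational equisectional equivalence $\sim_{\mathbb{Q}}$ is the equivalence relation on the set of triangles generated by similarity and $\{T_q\}_{q\in\mathbb{Q}}$. *)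

theory Defs
  imports "HOL-Analysis.Analysis"
begin

text \<open>A triangle is represented by its set of vertices, so that it carries no labelling.\<close>

definition is_triangle :: "complex set \<Rightarrow> bool" where
  "is_triangle T \<longleftrightarrow> card T = 3 \<and> \<not> collinear T"

definition anticlockwise :: "complex \<Rightarrow> complex \<Rightarrow> complex \<Rightarrow> bool" where
  "anticlockwise A B C \<longleftrightarrow> Im ((C - A) / (B - A)) > 0"

definition isosceles :: "complex set \<Rightarrow> bool" where
  "isosceles T \<longleftrightarrow> is_triangle T \<and> (\<exists>A B C. T = {A, B, C} \<and> dist A B = dist A C)"

definition regular :: "complex set \<Rightarrow> bool" where
  "regular T \<longleftrightarrow> is_triangle T \<and>
     (\<exists>A B C. T = {A, B, C} \<and> dist A B = dist B C \<and> dist B C = dist C A)"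

definition right_triangle :: "complex set \<Rightarrow> bool" where
  "right_triangle T \<longleftrightarrow> is_triangle T \<and>
     (\<exists>A B C. T = {A, B, C} \<and> orthogonal (B - A) (C - A))"

text \<open>The common difference may be zero, so regular triangles are SAP.\<close>

definition SAP :: "complex set \<Rightarrow> bool" where
  "SAP T \<longleftrightarrow> is_triangle T \<and>
     (\<exists>A B C. T = {A, B, C} \<and> dist B C - dist A B = dist C A - dist B C)"

definition side_lengths :: "complex set \<Rightarrow> real set" where
  "side_lengths T = {dist A B | A B. A \<in> T \<and> B \<in> T \<and> A \<noteq> B}"

text \<open>The orientation-preserving similarities of the complex plane are the maps
  \<open>z \<mapsto> a z + b\<close> with \<open>a \<noteq> 0\<close>.\<close>

definition similar :: "complex set \<Rightarrow> complex set \<Rightarrow> bool" where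
  "similar T T' \<longleftrightarrow> (\<exists>a b. a \<noteq> 0 \<and> (\<lambda>z. a * z + b) ` T = T')"

definition similarity_class :: "complex set \<Rightarrow> complex set set" where
  "similarity_class T = {T'. is_triangle T' \<and> similar T T'}"

text \<open>The three anticlockwise listings of a triangle are cyclic shifts of one another, so letting
  \<open>(A, B, C)\<close> range over them produces the three vertices of the image triangle;
  see \<open>equisect_eq\<close>.\<close>

definition equisect :: "real \<Rightarrow> complex set \<Rightarrow> complex set" where
  "equisect q T = {of_real q * B + of_real (1 - q) * C | A B C.
     T = {A, B, C} \<and> anticlockwise A B C}"

text \<open>The equivalence relation on triangles generated by similarity and the operators
  \<open>equisect q\<close> with \<open>q \<in> Q\<close>. (Other point sets are related only to themselves.)\<close>

definition equisect_equiv :: "real set \<Rightarrow> complex set \<Rightarrow> complex set \<Rightarrow> bool" where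
  "equisect_equiv Q = equivclp (\<lambda>T T'. is_triangle T \<and> is_triangle T' \<and>
     (similar T T' \<or> (\<exists>q\<in>Q. equisect q T = T')))"

lemma anticlockwise_iff:
  "anticlockwise A B C \<longleftrightarrow>
     (Re B - Re A) * (Im C - Im A) - (Im B - Im A) * (Re C - Re A) > 0"
proof (cases "A = B")
  case False
  then have "(Re B - Re A)\<^sup>2 + (Im B - Im A)\<^sup>2 > 0"
    by (auto simp: complex_eq_iff sum_power2_gt_zero_iff)
  then show ?thesis
    by (simp add: anticlockwise_def Im_divide zero_less_divide_iff algebra_simps)
qed (simp add: anticlockwise_def)

lemma anticlockwise_distinct: "anticlockwise A B C \<Longrightarrow> A \<noteq> B \<and> B \<noteq> C \<and> A \<noteq> C"
  by (auto simp: anticlockwise_iff)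

lemma equisect_eq:
  assumes "anticlockwise A B C"
  shows "equisect q {A, B, C} =
    {of_real q * B + of_real (1 - q) * C,
     of_real q * C + of_real (1 - q) * A,
     of_real q * A + of_real (1 - q) * B}"
proof -
  have no: "\<not> anticlockwise A C B" "\<not> anticlockwise C B A" "\<not> anticlockwise B A C"
    using assms by (simp_all add: anticlockwise_iff algebra_simps)
  have yes: "anticlockwise B C A" "anticlockwise C A B"
    using assms by (simp_all add: anticlockwise_iff algebra_simps)
  have "{A, B, C} = {X, Y, Z} \<and> anticlockwise X Y Z \<longleftrightarrow>
      (X, Y, Z) \<in> {(A, B, C), (B, C, A), (C, A, B)}"
    (is "?L \<longleftrightarrow> ?R") for X Y Z
  proof
    assume L: ?L
    then have "X \<in> {A, B, C}" "Y \<in> {A, B, C}" "Z \<in> {A, B, C}" by simp_all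
    moreover have "X \<noteq> Y \<and> Y \<noteq> Z \<and> X \<noteq> Z"
      using anticlockwise_distinct[of X Y Z] L by simp
    moreover have "anticlockwise X Y Z" using L by simp
    ultimately show ?R
      using no by (elim insertE emptyE) simp_all
  next
    assume ?R
    then consider "X = A" "Y = B" "Z = C" | "X = B" "Y = C" "Z = A" | "X = C" "Y = A" "Z = B"
      by auto
    then show ?L
      using assms yes by cases (simp_all add: insert_commute)
  qed
  then have "equisect q {A, B, C} = {of_real q * Y + of_real (1 - q) * Z | X Y Z.
      (X, Y, Z) \<in> {(A, B, C), (B, C, A), (C, A, B)}}"
    unfolding equisect_def by simp
  then show ?thesis by auto
qed

lemma triangle_anticlockwise:
  assumes "is_triangle T"
  obtains A B C where "T = {A, B, C}" "anticlockwise A B C"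
proof -
  from assms obtain A B C where T: "T = {A, B, C}" and ne: "A \<noteq> B"
    by (auto simp: is_triangle_def card_3_iff)
  have "anticlockwise A B C \<or> anticlockwise A C B"
  proof (rule ccontr)
    assume "\<not> ?thesis"
    then have *: "(Re B - Re A) * (Im C - Im A) = (Im B - Im A) * (Re C - Re A)"
      by (auto simp: anticlockwise_iff algebra_simps)
    have "Im ((C - A) / (B - A)) = 0"
      using * by (simp add: Im_divide algebra_simps)
    then have r: "(C - A) / (B - A) = of_real (Re ((C - A) / (B - A)))"
      by (simp add: complex_eq_iff)
    have "C - A = Re ((C - A) / (B - A)) *\<^sub>R (B - A)"
      using ne by (simp add: scaleR_conv_of_real r[symmetric])
    then have "\<forall>x\<in>{A, B, C}. \<exists>c. x = A + c *\<^sub>R (B - A)"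
      by (auto intro: exI[of _ 0] exI[of _ 1] exI[of _ "Re ((C - A) / (B - A))"]
          simp: algebra_simps)
    then have "collinear {A, B, C}"
      unfolding collinear_alt by blast
    with assms T show False by (simp add: is_triangle_def)
  qed
  then show ?thesis
    using that[of A B C] that[of A C B] T by (auto simp: insert_commute)
qed

end

theory Submission
  imports Defs
begin

text \<open>Write \<open>\<omega>\<close> for a primitive cube root of unity. An anticlockwise triangle \<open>ABC\<close> has the two discrete
  Fourier coefficients \<open>u = A + \<omega>\<^sup>2 B + \<omega> C\<close> and \<open>v = A + \<omega> B + \<omega>\<^sup>2 C\<close>, and its similarity class is
  determined by \<open>z = v / u\<close>, a point of the open unit disc that is well defined up to powers of \<open>\<omega>\<close>.
  The operator \<open>T\<^sub>q\<close> multiplies \<open>z\<close> by \<open>cnj \<lambda> / \<lambda>\<close> where \<open>\<lambda> = q \<omega> + (1 - q) \<omega>\<^sup>2\<close>; hence \<open>\<bar>z\<bar>\<close> is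
  invariant, and \<open>q\<close> is rational if and only if this factor lies in \<open>\<rat>(\<omega>)\<close>. Conversely every
  element \<open>\<noteq> -1\<close> of \<open>\<rat>(\<omega>)\<close> of modulus \<open>1\<close> is such a factor. Finally, if the
  side lengths are \<open>a, b, c\<close> then \<open>v * cnj u = - (a\<^sup>2 + \<omega> c\<^sup>2 + \<omega>\<^sup>2 b\<^sup>2)\<close> and \<open>\<bar>u\<bar>\<^sup>2 + \<bar>v\<bar>\<^sup>2 = a\<^sup>2 + b\<^sup>2 + c\<^sup>2\<close>, so
  \<open>z / (1 + \<bar>z\<bar>\<^sup>2)\<close> lies in \<open>\<rat>(\<omega>)\<close> for rational sides. Two such triangles with the same \<open>\<bar>z\<bar>\<close>
  therefore have values of \<open>z\<close> whose quotient is an element of \<open>\<rat>(\<omega>)\<close>.\<close>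

section \<open>Cube roots of unity and the field \<rat>(\<omega>)\<close>

definition omega :: complex where
  "omega = Complex (-1/2) (sqrt 3 / 2)"

lemma cnj_omega: "cnj omega = -1 - omega"
  by (simp add: omega_def complex_eq_iff)

lemma omega_sq: "omega * omega = -1 - omega"
  by (simp add: omega_def complex_eq_iff field_simps)

lemma omega_sq_left: "omega * (omega * x) = (-1 - omega) * x"
  by (simp only: omega_sq mult.assoc[symmetric])

lemma norm_omega: "norm omega = 1"
  by (simp add: omega_def cmod_def power_divide)

lemma omega_ne_0: "omega \<noteq> 0"
  by (simp add: omega_def complex_eq_iff)

text \<open>This is \<rat>(\<omega>), described by coordinates in the basis 1, i sqrt 3, so that
  membership becomes rationality of two real numbers.\<close>

definition Eisenstein_field :: "complex set" where
  "Eisenstein_field = {w. Re w \<in> \<rat> \<and> Im w / sqrt 3 \<in> \<rat>}"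

lemma Eisenstein_fieldE:
  assumes "w \<in> Eisenstein_field"
  obtains x y where "x \<in> \<rat>" "y \<in> \<rat>" "w = Complex x (sqrt 3 * y)"
  using assms that[of "Re w" "Im w / sqrt 3"]
  by (simp add: Eisenstein_field_def complex_eq_iff)

lemma Eisenstein_fieldI: "x \<in> \<rat> \<Longrightarrow> y \<in> \<rat> \<Longrightarrow> Complex x (sqrt 3 * y) \<in> Eisenstein_field"
  by (simp add: Eisenstein_field_def)

lemma Eisenstein_field_mult:
  assumes "w \<in> Eisenstein_field" "w' \<in> Eisenstein_field"
  shows "w * w' \<in> Eisenstein_field"
proof -
  obtain x y where w: "x \<in> \<rat>" "y \<in> \<rat>" "w = Complex x (sqrt 3 * y)"
    using assms by (auto elim: Eisenstein_fieldE)
  obtain x' y' where w': "x' \<in> \<rat>" "y' \<in> \<rat>" "w' = Complex x' (sqrt 3 * y')"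
    using assms by (auto elim: Eisenstein_fieldE)
  have "w * w' = Complex (x * x' - 3 * (y * y')) (sqrt 3 * (x * y' + y * x'))"
    by (simp add: w w' complex_eq_iff algebra_simps)
  moreover have "\<dots> \<in> Eisenstein_field"
    using w w' by (intro Eisenstein_fieldI) auto
  ultimately show ?thesis by simp
qed

lemma Eisenstein_field_inverse:
  assumes "w \<in> Eisenstein_field"
  shows "inverse w \<in> Eisenstein_field"
proof -
  obtain x y where w: "x \<in> \<rat>" "y \<in> \<rat>" "w = Complex x (sqrt 3 * y)"
    using assms by (auto elim: Eisenstein_fieldE)
  \<comment> \<open>Conjugate over norm; for \<open>w = 0\<close> both sides are 0 by the convention
    on division.\<close>
  have "inverse w = Complex (x / (x\<^sup>2 + 3 * y\<^sup>2)) (sqrt 3 * (- y / (x\<^sup>2 + 3 * y\<^sup>2)))"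
    by (simp add: w complex_eq_iff power_mult_distrib)
  moreover have "\<dots> \<in> Eisenstein_field"
    using w by (intro Eisenstein_fieldI) auto
  ultimately show ?thesis by simp
qed

lemma Eisenstein_field_divide:
  "w \<in> Eisenstein_field \<Longrightarrow> w' \<in> Eisenstein_field \<Longrightarrow> w / w' \<in> Eisenstein_field"
  by (simp add: divide_inverse Eisenstein_field_mult Eisenstein_field_inverse)

lemma of_real_in_Eisenstein_field: "x \<in> \<rat> \<Longrightarrow> of_real x \<in> Eisenstein_field"
  by (simp add: Eisenstein_field_def)

lemma omega_in_Eisenstein_field: "omega \<in> Eisenstein_field"
  by (simp add: Eisenstein_field_def omega_def)

section \<open>The unimodular factors of the equisection operators\<close>

definition rotation :: "real \<Rightarrow> complex" where
  "rotation q = (let l = of_real q * omega + of_real (1 - q) * cnj omega in cnj l / l)"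

lemma equisect_multiplier_ne_0: "of_real q * omega + of_real (1 - q) * cnj omega \<noteq> 0"
  by (simp add: omega_def complex_eq_iff)

text \<open>With p = 2q - 1 the number \<lambda> is (-1 + i sqrt 3 p) / 2, and the factor is (cnj
  \<lambda>)^2 / |\<lambda>|^2. This is the rational parametrisation of the unit circle by sqrt 3 p,
  the tangent of half the angle.\<close>

lemma rotation_conv:
  "rotation q = Complex (1 - 3 * (2 * q - 1)\<^sup>2) (2 * sqrt 3 * (2 * q - 1)) / of_real (1 + 3 * (2 * q - 1)\<^sup>2)"
proof -
  define p where "p = 2 * q - 1"
  have l: "of_real q * omega + of_real (1 - q) * cnj omega = Complex (-1/2) (sqrt 3 / 2 * p)"
    by (simp add: omega_def complex_eq_iff p_def algebra_simps)
  have pos: "1 + 3 * p\<^sup>2 > 0"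
    by (simp add: add_pos_nonneg)
  have "cnj (Complex (-1/2) (sqrt 3 / 2 * p)) * of_real (1 + 3 * p\<^sup>2) =
      Complex (1 - 3 * p\<^sup>2) (2 * sqrt 3 * p) * Complex (-1/2) (sqrt 3 / 2 * p)"
    by (simp add: complex_eq_iff power2_eq_square algebra_simps)
  moreover have "Complex (-1/2) (sqrt 3 / 2 * p) \<noteq> 0"
    by (simp add: complex_eq_iff)
  moreover have "complex_of_real (1 + 3 * p\<^sup>2) \<noteq> 0"
    using pos by (metis less_irrefl of_real_eq_0_iff)
  ultimately show ?thesis
    unfolding rotation_def l Let_def p_def[symmetric] by (subst frac_eq_eq) (simp_all only: mult.commute not_False_eq_True)
qed

lemma norm_rotation: "norm (rotation q) = 1"
  using equisect_multiplier_ne_0[of q] by (simp only: rotation_def Let_def norm_divide complex_mod_cnj) simp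

text \<open>The half-angle formula tan (s/2) = sin s / (1 + cos s) recovers p = 2q - 1 rationally
  from the two coordinates.\<close>

lemma rotation_rational_imp:
  assumes "rotation q \<in> Eisenstein_field"
  shows "q \<in> \<rat>"
proof -
  define p where "p = 2 * q - 1"
  have pos: "1 + 3 * p\<^sup>2 > 0"
    by (simp add: add_pos_nonneg)
  have re: "Re (rotation q) = (1 - 3 * p\<^sup>2) / (1 + 3 * p\<^sup>2)"
    and im: "Im (rotation q) / sqrt 3 = 2 * p / (1 + 3 * p\<^sup>2)"
    unfolding rotation_conv p_def[symmetric] Re_divide_of_real Im_divide_of_real by simp_all
  have "1 + Re (rotation q) = 2 / (1 + 3 * p\<^sup>2)"
    using pos unfolding re by (simp add: field_simps)
  then have "p = (Im (rotation q) / sqrt 3) / (1 + Re (rotation q))"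
    using pos unfolding im by simp
  moreover have "\<dots> \<in> \<rat>"
    using assms unfolding Eisenstein_field_def by (intro Rats_divide[of "_ / sqrt 3"] Rats_add) auto
  ultimately have "(p + 1) / 2 \<in> \<rat>" by simp
  then show ?thesis by (simp add: p_def)
qed

text \<open>The parameter is the one read off in \<open>rotation_rational_imp\<close>; the value \<open>-1\<close> would
  correspond to \<open>q = \<infinity>\<close>.\<close>

lemma rotation_surj:
  assumes "w \<in> Eisenstein_field" "norm w = 1" "w \<noteq> -1"
  obtains q where "q \<in> \<rat>" "rotation q = w"
proof -
  obtain x y where w: "x \<in> \<rat>" "y \<in> \<rat>" "w = Complex x (sqrt 3 * y)"
    using assms by (auto elim: Eisenstein_fieldE)
  have n: "x\<^sup>2 + 3 * y\<^sup>2 = 1"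
    using assms(2) by (simp add: w cmod_def power_mult_distrib)
  have x: "1 + x \<noteq> 0"
  proof
    assume "1 + x = 0"
    then have "x = -1" by simp
    with n have "y = 0" by simp
    with \<open>x = -1\<close> assms(3) show False by (simp add: w complex_eq_iff)
  qed
  define p where "p = y / (1 + x)"
  have y: "y = p * (1 + x)" using x by (simp add: p_def)
  \<comment> \<open>Here \<open>p\<close> is the slope of the line joining (-1, 0) to (x, y) on the
    conic x^2 + 3 y^2 = 1. Splitting off the known intersection x = -1 leaves an equation linear in
    \<open>x\<close>.\<close>
  have "(1 + x) * (x - 1 + 3 * p\<^sup>2 * (1 + x)) = 0"
    using n unfolding y by (simp add: power2_eq_square algebra_simps)
  with x have "x - 1 + 3 * p\<^sup>2 * (1 + x) = 0"
    by (metis mult_eq_0_iff)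
  then have e: "x * (1 + 3 * p\<^sup>2) = 1 - 3 * p\<^sup>2"
    by (simp add: algebra_simps)
  have "y * (1 + 3 * p\<^sup>2) = p * ((1 + 3 * p\<^sup>2) + x * (1 + 3 * p\<^sup>2))"
    unfolding y by (simp add: algebra_simps)
  also have "\<dots> = 2 * p" unfolding e by simp
  finally have e': "y * (1 + 3 * p\<^sup>2) = 2 * p" .
  have pos: "1 + 3 * p\<^sup>2 > 0"
    by (simp add: add_pos_nonneg)
  have q: "2 * ((p + 1) / 2) - 1 = p" by (simp add: field_simps)
  have "rotation ((p + 1) / 2) = w"
    using e pos arg_cong[OF e', of "\<lambda>t. sqrt 3 * t"]
    unfolding rotation_conv q w complex_eq_iff Re_divide_of_real Im_divide_of_real
    by (simp add: field_simps)
  moreover have "(p + 1) / 2 \<in> \<rat>" using w by (simp add: p_def)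
  ultimately show ?thesis using that by blast
qed

section \<open>Fourier coefficients, orientation and shapes\<close>

definition fourier1 :: "complex \<Rightarrow> complex \<Rightarrow> complex \<Rightarrow> complex" where
  "fourier1 A B C = A + cnj omega * B + omega * C"

definition fourier2 :: "complex \<Rightarrow> complex \<Rightarrow> complex \<Rightarrow> complex" where
  "fourier2 A B C = A + omega * B + cnj omega * C"

text \<open>The difference |u|^2 - |v|^2 is 4 sqrt 3 times the signed area. Orientation of an image
  triangle can thus be checked on its coefficients alone.\<close>

lemma anticlockwise_iff_fourier:
  "anticlockwise A B C \<longleftrightarrow> norm (fourier2 A B C) < norm (fourier1 A B C)"
proof -
  have "(norm (fourier1 A B C))\<^sup>2 - (norm (fourier2 A B C))\<^sup>2 =
      2 * sqrt 3 * ((Re B - Re A) * (Im C - Im A) - (Im B - Im A) * (Re C - Re A))"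
    unfolding cmod_power2
    by (simp add: fourier1_def fourier2_def omega_def power2_eq_square algebra_simps)
  then have "anticlockwise A B C \<longleftrightarrow> (norm (fourier1 A B C))\<^sup>2 - (norm (fourier2 A B C))\<^sup>2 > 0"
    by (simp only: anticlockwise_iff zero_less_mult_iff) simp
  also have "\<dots> \<longleftrightarrow> norm (fourier2 A B C) < norm (fourier1 A B C)"
    by (simp add: power_mono_iff not_le[symmetric])
  finally show ?thesis .
qed

lemma anticlockwise_fourier1_ne_0: "anticlockwise A B C \<Longrightarrow> fourier1 A B C \<noteq> 0"
  by (auto simp: anticlockwise_iff_fourier)

lemma anticlockwise_is_triangle:
  assumes "anticlockwise A B C"
  shows "is_triangle {A, B, C}"
proof -
  have "\<not> collinear {A, B, C}"
  proof
    assume "collinear {A, B, C}"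
    then obtain P d where "\<forall>x\<in>{A, B, C}. \<exists>c. x = P + c *\<^sub>R d"
      unfolding collinear_alt by blast
    then obtain a b c where "A = P + a *\<^sub>R d" "B = P + b *\<^sub>R d" "C = P + c *\<^sub>R d"
      by auto
    then have "(Re B - Re A) * (Im C - Im A) - (Im B - Im A) * (Re C - Re A) = 0"
      by (simp add: algebra_simps)
    with assms show False by (simp add: anticlockwise_iff)
  qed
  then show ?thesis
    using anticlockwise_distinct[OF assms] by (simp add: is_triangle_def)
qed

text \<open>A set, because an unlabelled triangle has three anticlockwise listings, whose quotients
  z differ by powers of \<omega>. It is empty unless \<open>T\<close> is a triangle.\<close>

definition shapes :: "complex set \<Rightarrow> complex set" where
  "shapes T = {fourier2 A B C / fourier1 A B C | A B C. T = {A, B, C} \<and> anticlockwise A B C}"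

lemma shapesI: "anticlockwise A B C \<Longrightarrow> fourier2 A B C / fourier1 A B C \<in> shapes {A, B, C}"
  unfolding shapes_def by blast

lemma shapesE:
  assumes "z \<in> shapes T"
  obtains A B C where "T = {A, B, C}" "anticlockwise A B C" "fourier2 A B C = z * fourier1 A B C"
proof -
  obtain A B C where "T = {A, B, C}" "anticlockwise A B C" "z = fourier2 A B C / fourier1 A B C"
    using assms unfolding shapes_def by blast
  then show ?thesis
    using that anticlockwise_fourier1_ne_0 by (metis nonzero_eq_divide_eq)
qed

lemma shapes_is_triangle: "z \<in> shapes T \<Longrightarrow> is_triangle T"
  by (auto elim!: shapesE simp: anticlockwise_is_triangle)

lemma triangle_shape:
  assumes "is_triangle T"
  obtains z where "z \<in> shapes T"
  using assms shapesI by (metis triangle_anticlockwise)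

lemma fourier_rotate:
  "fourier1 B C A = omega * fourier1 A B C" "fourier2 B C A = cnj omega * fourier2 A B C"
  by (simp_all add: fourier1_def fourier2_def cnj_omega algebra_simps omega_sq omega_sq_left)

text \<open>A cyclic shift of the listing multiplies u by \<omega> and v by its conjugate, hence z
  by \<omega>.\<close>

lemma shapes_omega:
  assumes "z \<in> shapes T"
  shows "omega * z \<in> shapes T"
proof -
  obtain A B C where T: "T = {A, B, C}" and ac: "anticlockwise A B C"
    and z: "fourier2 A B C = z * fourier1 A B C"
    using assms by (rule shapesE)
  have ac': "anticlockwise B C A"
    using ac by (simp add: anticlockwise_iff algebra_simps)
  have "cnj omega = omega * omega"
    by (simp add: cnj_omega omega_sq)
  then have "fourier2 B C A / fourier1 B C A = omega * z"
    using anticlockwise_fourier1_ne_0[OF ac] omega_ne_0 by (simp add: fourier_rotate[where A = A and B = B and C = C] z)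
  moreover have "T = {B, C, A}" using T by auto
  ultimately show ?thesis using shapesI[OF ac'] by simp
qed

lemma anticlockwise_listings:
  assumes "anticlockwise A B C" "anticlockwise X Y Z" "{A, B, C} = {X, Y, Z}"
  shows "(X, Y, Z) \<in> {(A, B, C), (B, C, A), (C, A, B)}"
proof -
  have "\<not> anticlockwise A C B" "\<not> anticlockwise C B A" "\<not> anticlockwise B A C"
    using assms(1) by (simp_all add: anticlockwise_iff algebra_simps)
  moreover have "X \<in> {A, B, C}" "Y \<in> {A, B, C}" "Z \<in> {A, B, C}"
    using assms(3) by simp_all
  moreover note anticlockwise_distinct[OF assms(2)] assms(2)
  ultimately show ?thesis by (elim insertE emptyE) simp_all
qed

text \<open>The listings are cyclic shifts of one another, which change u and v only by factors of
  modulus 1. The image set thus encodes the invariant |z| without a choice of listing.\<close>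

lemma norm_shapes:
  assumes "z \<in> shapes T"
  shows "norm ` shapes T = {norm z}"
proof -
  obtain A B C where T: "T = {A, B, C}" and ac: "anticlockwise A B C"
    and z: "fourier2 A B C = z * fourier1 A B C"
    using assms by (rule shapesE)
  have nu: "fourier1 A B C \<noteq> 0" by (rule anticlockwise_fourier1_ne_0[OF ac])
  have "norm z' = norm z" if "z' \<in> shapes T" for z'
  proof -
    obtain X Y Z where T': "T = {X, Y, Z}" and ac': "anticlockwise X Y Z"
      and z': "fourier2 X Y Z = z' * fourier1 X Y Z"
      using \<open>z' \<in> shapes T\<close> by (rule shapesE)
    have rot: "norm (fourier1 B C A) = norm (fourier1 A B C)"
      "norm (fourier2 B C A) = norm (fourier2 A B C)" for A B C
      unfolding fourier_rotate[where A = A and B = B and C = C] by (simp_all add: norm_mult norm_omega)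
    have "(X, Y, Z) \<in> {(A, B, C), (B, C, A), (C, A, B)}"
      using anticlockwise_listings[OF ac ac'] T T' by simp
    then have "norm (fourier1 X Y Z) = norm (fourier1 A B C) \<and>
        norm (fourier2 X Y Z) = norm (fourier2 A B C)" (is "?P \<and> ?Q")
      using rot[where A = A and B = B and C = C] rot[where A = B and B = C and C = A]
      by (elim insertE emptyE) simp_all
    then have ?P ?Q by simp_all
    then show ?thesis using z z' nu by (simp add: norm_mult)
  qed
  then have "norm ` shapes T \<subseteq> {norm z}"
    by blast
  moreover have "norm z \<in> norm ` shapes T"
    using assms by (rule imageI)
  ultimately show ?thesis by blast
qed

section \<open>Action of similarities and equisection on shapes\<close>

lemma similar_shapes:
  assumes "similar T T'" "z \<in> shapes T"
  shows "z \<in> shapes T'"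
proof -
  obtain a b where a: "a \<noteq> 0" and T': "(\<lambda>z. a * z + b) ` T = T'"
    using assms(1) by (auto simp: similar_def)
  obtain A B C where T: "T = {A, B, C}" and ac: "anticlockwise A B C"
    and z: "fourier2 A B C = z * fourier1 A B C"
    using assms(2) by (rule shapesE)
  \<comment> \<open>The translation drops out because the three cube roots of unity sum to
    0.\<close>
  have f: "fourier1 (a * A + b) (a * B + b) (a * C + b) = a * fourier1 A B C"
    "fourier2 (a * A + b) (a * B + b) (a * C + b) = a * fourier2 A B C"
    by (simp_all add: fourier1_def fourier2_def cnj_omega algebra_simps)
  have ac': "anticlockwise (a * A + b) (a * B + b) (a * C + b)"
    using ac a by (simp add: anticlockwise_iff_fourier f norm_mult)
  show ?thesis
    using shapesI[OF ac'] a T T' anticlockwise_fourier1_ne_0[OF ac] by (simp add: f z)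
qed

text \<open>Inverse discrete Fourier transform; the sum of the vertices is the coefficient at
  frequency 0.\<close>

lemma fourier_inversion:
  "3 * A = (A + B + C) + fourier1 A B C + fourier2 A B C"
  "3 * B = (A + B + C) + omega * fourier1 A B C + cnj omega * fourier2 A B C"
  "3 * C = (A + B + C) + cnj omega * fourier1 A B C + omega * fourier2 A B C"
  by (simp_all add: fourier1_def fourier2_def cnj_omega algebra_simps omega_sq omega_sq_left)

text \<open>With equal z, the pairs (u, v) of the two triangles are proportional. The ratio is the
  linear coefficient \<open>a\<close> of the similarity, and \<open>b\<close> matches the
  centroids.\<close>

lemma shapes_similar:
  assumes "z \<in> shapes T" "z \<in> shapes T'"
  shows "similar T T'"
proof -
  obtain A B C where T: "T = {A, B, C}" and ac: "anticlockwise A B C"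
    and z: "fourier2 A B C = z * fourier1 A B C"
    using assms(1) by (rule shapesE)
  obtain X Y Z where T': "T' = {X, Y, Z}" and ac': "anticlockwise X Y Z"
    and z': "fourier2 X Y Z = z * fourier1 X Y Z"
    using assms(2) by (rule shapesE)
  define a where "a = fourier1 X Y Z / fourier1 A B C"
  define b where "b = ((X + Y + Z) - a * (A + B + C)) / 3"
  have u: "fourier1 X Y Z = a * fourier1 A B C"
    using anticlockwise_fourier1_ne_0[OF ac] by (simp add: a_def)
  have v: "fourier2 X Y Z = a * fourier2 A B C"
    using z z' u by simp
  have b: "3 * b = (X + Y + Z) - a * (A + B + C)" by (simp add: b_def)
  have eq: "3 * (a * w + b) = a * (3 * w) + 3 * b" for w
    by (simp add: algebra_simps)
  have "3 * (a * A + b) = 3 * X" "3 * (a * B + b) = 3 * Y" "3 * (a * C + b) = 3 * Z"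
    unfolding eq b fourier_inversion[where A = A and B = B and C = C]
      fourier_inversion[where A = X and B = Y and C = Z] u v
    by (simp_all add: algebra_simps)
  then have "a * A + b = X" "a * B + b = Y" "a * C + b = Z"
    by (simp_all only: mult_cancel_left) simp_all
  then have "(\<lambda>z. a * z + b) ` T = T'"
    by (simp add: T T')
  moreover have "a \<noteq> 0"
    using anticlockwise_fourier1_ne_0[OF ac'] u by auto
  ultimately show ?thesis unfolding similar_def by blast
qed

text \<open>The operator is circulant, so the Fourier transform diagonalises it: u is multiplied by
  \<lambda> and v by its conjugate. As these have equal modulus, orientation is kept.\<close>

lemma equisect_shapes:
  assumes "z \<in> shapes T"
  shows "rotation q * z \<in> shapes (equisect q T)"
proof -
  obtain A B C where T: "T = {A, B, C}" and ac: "anticlockwise A B C"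
    and z: "fourier2 A B C = z * fourier1 A B C"
    using assms by (rule shapesE)
  define l where "l = of_real q * omega + of_real (1 - q) * cnj omega"
  have l0: "l \<noteq> 0" unfolding l_def by (rule equisect_multiplier_ne_0)
  have rot: "rotation q = cnj l / l"
    by (simp only: rotation_def Let_def l_def)
  define X where "X = of_real q * B + of_real (1 - q) * C"
  define Y where "Y = of_real q * C + of_real (1 - q) * A"
  define Z where "Z = of_real q * A + of_real (1 - q) * B"
  have eq: "equisect q T = {X, Y, Z}"
    unfolding T X_def Y_def Z_def by (rule equisect_eq[OF ac])
  have u: "fourier1 X Y Z = l * fourier1 A B C" and v: "fourier2 X Y Z = cnj l * fourier2 A B C"
    unfolding fourier1_def fourier2_def X_def Y_def Z_def l_def
    by (simp_all add: cnj_omega algebra_simps omega_sq omega_sq_left)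
  have "anticlockwise X Y Z"
    using ac l0 by (simp add: anticlockwise_iff_fourier u v norm_mult)
  then have "fourier2 X Y Z / fourier1 X Y Z \<in> shapes (equisect q T)"
    unfolding eq by (rule shapesI)
  moreover have "fourier2 X Y Z / fourier1 X Y Z = rotation q * z"
    using anticlockwise_fourier1_ne_0[OF ac] by (simp add: u v z rot)
  ultimately show ?thesis by simp
qed

lemma equisect_equiv_norm_shapes:
  assumes "equisect_equiv Q T T'"
  shows "norm ` shapes T = norm ` shapes T'"
  using assms unfolding equisect_equiv_def
proof (induction rule: equivclp_induct)
  case (step Y Z)
  have inv: "norm ` shapes Y = norm ` shapes Z"
    if Y: "is_triangle Y" and YZ: "similar Y Z \<or> (\<exists>q\<in>Q. equisect q Y = Z)" for Y Z
  proof -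
    obtain z where z: "z \<in> shapes Y"
      using Y by (rule triangle_shape)
    obtain w where w: "w \<in> shapes Z" "norm w = norm z"
      using YZ
    proof
      assume "similar Y Z"
      then show ?thesis using similar_shapes z that by blast
    next
      assume "\<exists>q\<in>Q. equisect q Y = Z"
      then obtain q where "equisect q Y = Z" by blast
      then show ?thesis
        using equisect_shapes[OF z, of q] that by (auto simp: norm_mult norm_rotation)
    qed
    show ?thesis using norm_shapes[OF z] norm_shapes[OF w(1)] w(2) by simp
  qed
  have "norm ` shapes Y = norm ` shapes Z"
    using step.hyps(2)
  proof
    assume "is_triangle Y \<and> is_triangle Z \<and> (similar Y Z \<or> (\<exists>q\<in>Q. equisect q Y = Z))"
    then show ?thesis by (intro inv) blast+
  next
    assume "is_triangle Z \<and> is_triangle Y \<and> (similar Z Y \<or> (\<exists>q\<in>Q. equisect q Z = Y))"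
    then show ?thesis by (intro inv[symmetric]) blast+
  qed
  with step.IH show ?case by (rule trans)
qed simp

section \<open>Shapes of triangles with rational sides\<close>

lemma fourier2_cnj_fourier1:
  "fourier2 A B C * cnj (fourier1 A B C) =
     - (of_real ((dist B C)\<^sup>2) + omega * of_real ((dist A B)\<^sup>2) + cnj omega * of_real ((dist A C)\<^sup>2))"
proof -
  have inv: "-1 - (-1 - omega) = omega" by simp
  \<comment> \<open>A polynomial identity with \<open>P\<close>, \<open>Q\<close>, \<open>R\<close>
    in place of the conjugates; its last summand carries the factor w^2 + w + 1, which vanishes at
    \<omega>.\<close>
  have "(A + w * B + (-1 - w) * C) * (P + w * Q + (-1 - w) * R) =
      - ((B - C) * (Q - R) + w * ((A - B) * (P - Q)) + (-1 - w) * ((A - C) * (P - R)))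
      + (w * w - (-1 - w)) * ((B - C) * (Q - R))" for w P Q R :: complex
    by (simp add: algebra_simps)
  from this[where w = omega and P = "cnj A" and Q = "cnj B" and R = "cnj C"] show ?thesis
    unfolding dist_norm complex_norm_square fourier1_def fourier2_def
    by (simp only: complex_cnj_add complex_cnj_mult complex_cnj_cnj complex_cnj_diff complex_cnj_minus
        complex_cnj_one cnj_omega inv omega_sq diff_self mult_zero_left mult_zero_right add_0_right)
qed

lemma norm_fourier_sum:
  "(norm (fourier1 A B C))\<^sup>2 + (norm (fourier2 A B C))\<^sup>2 = (dist B C)\<^sup>2 + (dist A B)\<^sup>2 + (dist A C)\<^sup>2"
proof -
  have inv: "-1 - (-1 - omega) = omega" by simp
  \<comment> \<open>Again the correction term contains w^2 + w + 1.\<close>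
  have eq: "(A + (-1 - w) * B + w * C) * (P + w * Q + (-1 - w) * R) +
      (A + w * B + (-1 - w) * C) * (P + (-1 - w) * Q + w * R) =
      (B - C) * (Q - R) + (A - B) * (P - Q) + (A - C) * (P - R)
      - 2 * ((w * w - (-1 - w)) * ((B - C) * (Q - R)))" for w P Q R :: complex
    by (simp add: algebra_simps)
  have "complex_of_real ((norm (fourier1 A B C))\<^sup>2 + (norm (fourier2 A B C))\<^sup>2) =
      of_real ((dist B C)\<^sup>2 + (dist A B)\<^sup>2 + (dist A C)\<^sup>2)"
    using eq[where w = omega and P = "cnj A" and Q = "cnj B" and R = "cnj C"]
    unfolding of_real_add dist_norm complex_norm_square fourier1_def fourier2_def
    by (simp only: complex_cnj_add complex_cnj_mult complex_cnj_cnj complex_cnj_diff complex_cnj_minus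
        complex_cnj_one cnj_omega inv omega_sq diff_self mult_zero_left mult_zero_right diff_0_right)
  then show ?thesis by (simp only: of_real_eq_iff)
qed

text \<open>In general z itself is not in \<rat>(\<omega>), since |u|^2 involves sqrt 3 times the
  area. Dividing by 1 + |z|^2 cancels |u|^2 and leaves v cnj u / (|u|^2 + |v|^2).\<close>

lemma rational_shape:
  assumes "z \<in> shapes T" "side_lengths T \<subseteq> \<rat>"
  shows "z / of_real (1 + (norm z)\<^sup>2) \<in> Eisenstein_field"
proof -
  obtain A B C where T: "T = {A, B, C}" and ac: "anticlockwise A B C"
    and z: "fourier2 A B C = z * fourier1 A B C"
    using assms by (auto elim: shapesE)
  define a b c where "a = dist B C" and "b = dist A C" and "c = dist A B"
  have "a \<in> side_lengths T" "b \<in> side_lengths T" "c \<in> side_lengths T"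
    unfolding side_lengths_def a_def b_def c_def T
    using anticlockwise_distinct[OF ac] by blast+
  then have rat: "a \<in> \<rat>" "b \<in> \<rat>" "c \<in> \<rat>"
    using assms(2) by auto
  let ?u = "fourier1 A B C"
  let ?N = "- (of_real (a\<^sup>2) + omega * of_real (c\<^sup>2) + cnj omega * of_real (b\<^sup>2))"
  have u0: "?u \<noteq> 0" by (rule anticlockwise_fourier1_ne_0[OF ac])
  have N: "?N = z * of_real ((norm ?u)\<^sup>2)"
    using fourier2_cnj_fourier1[of A B C]
    unfolding z a_def[symmetric] b_def[symmetric] c_def[symmetric]
    by (simp only: mult.assoc complex_norm_square)
  have s: "a\<^sup>2 + c\<^sup>2 + b\<^sup>2 = (norm ?u)\<^sup>2 * (1 + (norm z)\<^sup>2)"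
    using norm_fourier_sum[of A B C]
    unfolding z a_def[symmetric] b_def[symmetric] c_def[symmetric]
    by (simp add: norm_mult power_mult_distrib algebra_simps)
  have "z / of_real (1 + (norm z)\<^sup>2) = ?N / of_real (a\<^sup>2 + c\<^sup>2 + b\<^sup>2)"
    unfolding N s using u0 by simp
  also have "\<dots> \<in> Eisenstein_field"
  proof (rule Eisenstein_field_divide)
    have "?N = Complex (- a\<^sup>2 + (b\<^sup>2 + c\<^sup>2) / 2) (sqrt 3 * ((b\<^sup>2 - c\<^sup>2) / 2))"
      by (simp add: omega_def complex_eq_iff field_simps)
    also have "\<dots> \<in> Eisenstein_field"
      using rat by (intro Eisenstein_fieldI) auto
    finally show "?N \<in> Eisenstein_field" .
    show "of_real (a\<^sup>2 + c\<^sup>2 + b\<^sup>2) \<in> Eisenstein_field"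
      using rat by (intro of_real_in_Eisenstein_field) auto
  qed
  finally show ?thesis .
qed

lemma rational_shape_quotient:
  assumes "z \<in> shapes T" "side_lengths T \<subseteq> \<rat>" "z' \<in> shapes T'" "side_lengths T' \<subseteq> \<rat>"
    and "norm z = norm z'"
  shows "z' / z \<in> Eisenstein_field"
proof -
  have "1 + (norm z)\<^sup>2 > 0"
    by (simp add: add_pos_nonneg)
  then have "complex_of_real (1 + (norm z)\<^sup>2) \<noteq> 0"
    by (metis less_irrefl of_real_eq_0_iff)
  \<comment> \<open>The common real factor cancels; for \<open>z = 0\<close> both sides are 0 by the
    convention on division.\<close>
  then have "z' / z = (z' / of_real (1 + (norm z')\<^sup>2)) / (z / of_real (1 + (norm z)\<^sup>2))"
    unfolding assms(5)[symmetric] by simp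
  then show ?thesis
    using Eisenstein_field_divide rational_shape assms by metis
qed

text \<open>The only real linear relations among the three cube roots of unity have equal
  coefficients, so v = 0 forces equal squared sides.\<close>

lemma zero_shape_regular:
  assumes "0 \<in> shapes T"
  shows "regular T"
proof -
  obtain A B C where T: "T = {A, B, C}" and ac: "anticlockwise A B C"
    and z: "fourier2 A B C = 0"
    using assms by (auto elim: shapesE)
  have "of_real ((dist B C)\<^sup>2) + omega * of_real ((dist A B)\<^sup>2) + cnj omega * of_real ((dist A C)\<^sup>2) = 0"
    using fourier2_cnj_fourier1[of A B C] z by (metis mult_zero_left neg_equal_0_iff_equal)
  then have *: "2 * (dist B C)\<^sup>2 = (dist A B)\<^sup>2 + (dist A C)\<^sup>2" "dist A B = dist A C"
    by (auto simp: omega_def complex_eq_iff)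
  then have "(dist B C)\<^sup>2 = (dist A C)\<^sup>2"
    by simp
  then have "dist A B = dist B C" "dist B C = dist C A"
    using *(2) by (simp_all add: dist_commute)
  then show ?thesis
    using T shapes_is_triangle[OF assms] unfolding regular_def by blast
qed

section \<open>Equivalence of triangles with equal invariant\<close>

lemma equisect_equiv_trans:
  "equisect_equiv Q T T' \<Longrightarrow> equisect_equiv Q T' T'' \<Longrightarrow> equisect_equiv Q T T''"
  unfolding equisect_equiv_def by (rule equivclp_trans)

text \<open>Two generating steps suffice: apply the operator, then a similarity onto
  \<open>T'\<close>, which shares the shape \<open>z'\<close> with the image.\<close>

lemma equisect_equivI:
  assumes "z \<in> shapes T" "z' \<in> shapes T'" "q \<in> Q" "z' = rotation q * z"
  shows "equisect_equiv Q T T'"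
proof -
  have z': "z' \<in> shapes (equisect q T)"
    using equisect_shapes[OF assms(1), of q] assms(4) by simp
  have "equisect_equiv Q T (equisect q T)"
    using assms shapes_is_triangle z' unfolding equisect_equiv_def by (intro r_into_equivclp) blast
  moreover have "equisect_equiv Q (equisect q T) T'"
    using shapes_similar[OF z' assms(2)] shapes_is_triangle z' assms(2)
    unfolding equisect_equiv_def by (intro r_into_equivclp) blast
  ultimately show ?thesis by (rule equisect_equiv_trans)
qed

lemma equisect_equiv_mono:
  assumes "equisect_equiv Q T T'" "Q \<subseteq> R"
  shows "equisect_equiv R T T'"
  using assms(1) unfolding equisect_equiv_def
proof (induction rule: equivclp_induct)
  case (step Y Z)
  have "equisect_equiv R Y Z"
    using step.hyps(2)
  proof
    assume "is_triangle Y \<and> is_triangle Z \<and> (similar Y Z \<or> (\<exists>q\<in>Q. equisect q Y = Z))"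
    with assms(2) show ?thesis
      unfolding equisect_equiv_def by (intro r_into_equivclp) blast
  next
    assume "is_triangle Z \<and> is_triangle Y \<and> (similar Z Y \<or> (\<exists>q\<in>Q. equisect q Z = Y))"
    with assms(2) show ?thesis
      unfolding equisect_equiv_def by (intro equivclp_sym[OF r_into_equivclp]) blast
  qed
  with step.IH show ?case
    unfolding equisect_equiv_def by (rule equivclp_trans)
qed simp

lemma equisect_equiv_Rats_if_norm_eq:
  assumes "z \<in> shapes T" "side_lengths T \<subseteq> \<rat>" "z' \<in> shapes T'" "side_lengths T' \<subseteq> \<rat>"
    and "norm z = norm z'"
  shows "equisect_equiv \<rat> T T'"
proof -
  obtain w where w: "w \<in> Eisenstein_field" "norm w = 1" "z' = w * z"
  \<comment> \<open>For \<open>z = 0\<close> also \<open>z' = 0\<close>, and the quotient would not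
    have modulus 1; the factor 1 serves instead.\<close>
  proof (cases "z = 0")
    case True
    then show ?thesis
      using that[of 1] of_real_in_Eisenstein_field[of 1] assms(5) by simp
  next
    case False
    then show ?thesis
      using that[of "z' / z"] rational_shape_quotient[OF assms] by (simp add: norm_divide assms(5)[symmetric])
  qed
  \<comment> \<open>The value -1 is not attained by \<open>rotation\<close>. If it occurs, another
    listing of \<open>T'\<close> replaces it by -\<omega>.\<close>
  obtain w' z'' where w': "w' \<in> Eisenstein_field" "norm w' = 1" "z'' = w' * z" "w' \<noteq> -1"
    and z'': "z'' \<in> shapes T'"
  proof (cases "w = -1")
    case True
    have "omega * w \<noteq> -1"
      by (simp add: True omega_def complex_eq_iff)
    then show ?thesis
      using that[of "omega * w" "omega * z'"] w shapes_omega[OF assms(3)]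
      by (simp add: Eisenstein_field_mult omega_in_Eisenstein_field norm_mult norm_omega)
  next
    case False
    then show ?thesis using that[of w z'] w assms(3) by blast
  qed
  obtain q where "q \<in> \<rat>" "rotation q = w'"
    using rotation_surj[OF w'(1,2,4)] .
  then show ?thesis
    using equisect_equivI[OF assms(1) z''] w'(3) by blast
qed

theorem theorem7:
  fixes D D' :: "complex set"
  assumes "is_triangle D" and "is_triangle D'"
    and "(isosceles D \<and> isosceles D') \<or> (right_triangle D \<and> right_triangle D') \<or> (SAP D \<and> SAP D')"
    and "side_lengths D \<subseteq> \<rat>" and "side_lengths D' \<subseteq> \<rat>"
  shows "(\<forall>q::real. \<not> regular D \<and> \<not> regular D' \<and>
            similarity_class (equisect q D) = similarity_class D' \<longrightarrow> q \<in> \<rat>) \<and>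
         (equisect_equiv UNIV D D' \<longleftrightarrow> equisect_equiv \<rat> D D')"
proof (intro conjI allI impI)
  obtain z where z: "z \<in> shapes D"
    using assms(1) by (rule triangle_shape)
  obtain z' where z': "z' \<in> shapes D'"
    using assms(2) by (rule triangle_shape)
  show "q \<in> \<rat>" if h: "\<not> regular D \<and> \<not> regular D' \<and>
      similarity_class (equisect q D) = similarity_class D'" for q
  proof -
    have "D' \<in> similarity_class D'"
      using assms(2) shapes_similar[OF z' z'] by (simp add: similarity_class_def)
    then have "similar (equisect q D) D'"
      using h unfolding similarity_class_def by blast
    then have D': "rotation q * z \<in> shapes D'"
      using equisect_shapes[OF z] by (rule similar_shapes)
    \<comment> \<open>Non-regularity enters here: for z = 0 every \<open>q\<close> gives the same
      class, whereas for nonzero z the factor can be recovered as a quotient of shapes.\<close>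
    have "z \<noteq> 0"
      using h z zero_shape_regular by blast
    moreover have "(rotation q * z) / z \<in> Eisenstein_field"
      using rational_shape_quotient[OF z assms(4) D' assms(5)] by (simp add: norm_mult norm_rotation)
    ultimately show ?thesis
      by (intro rotation_rational_imp) simp
  qed
  show "equisect_equiv UNIV D D' \<longleftrightarrow> equisect_equiv \<rat> D D'"
  proof
    assume "equisect_equiv UNIV D D'"
    then have "norm ` shapes D = norm ` shapes D'"
      by (rule equisect_equiv_norm_shapes)
    then have "norm z = norm z'"
      using norm_shapes[OF z] norm_shapes[OF z'] by simp
    then show "equisect_equiv \<rat> D D'"
      using equisect_equiv_Rats_if_norm_eq[OF z assms(4) z' assms(5)] by blast
  next
    assume "equisect_equiv \<rat> D D'"
    then show "equisect_equiv UNIV D D'"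
      by (rule equisect_equiv_mono) simp
  qed
qed

end
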